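(* Let $X$ be a locale whose frame is given by a $\mathbf{Sup}$-type presentation $\mathcal{O}X = \langle G \text{ } \wedge\text{-semilattice} \mid R\rangle_{\mathbf{Frm}}$, and let $q\colon X \twoheadrightarrow Y$ be a semi-open quotient. Then $$\mathcal{O}Y \cong \langle \Diamond g,\ g \in G \mid R,\ \Diamond 1 = 1,\ \Diamond s \wedge \Diamond t = \Diamond(q^*q_!(s) \wedge q^*q_!(t)),\ s,t \in G\rangle_{\mathbf{Frm}},$$ where the generators $\Diamond g$ are indexed by the underlying set of $G$; $\Diamond(q^*q_!(s)\wedge q^*q_!(t))$ is interpreted as $\bigvee_{\alpha,\beta} \Diamond(s_\alpha \wedge t_\beta)$ for specified representations $q^*q_!(s)=\bigvee_\alpha s_\alpha$ and $q^*q_!(t)=\bigvee_\beta t_\beta$ in $\mathcal{O}X$ in terms of generators $s_\alpha, t_\beta \in G$ (with $s_\alpha\wedge t_\beta$ computed in $G$); and each relation $\bigvee A \le \bigvee B$ of $R$ is read as $\bigvee_{a\in A}\Diamond a \le \bigvee_{b\in B}\Diamond b$.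
   Context: For a locale $X$, $\mathcal{O}X$ denotes its frame; a locale map $f\colon X\to Y$ corresponds to a frame homomorphism $f^*\colon\mathcal{O}Y\to\mathcal{O}X$. $f$ is semi-open if $f^*$ has a left adjoint $f_!\colon \mathcal{O}X\to\mathcal{O}Y$; a semi-open quotient is an epic (i.e. $f^*$ injective) semi-open map. $\langle G\mid R\rangle_{\mathbf{Frm}}$ denotes the frame presented by generators $G$ and relations $R$ (formal equalities and inequalities between elements of the free frame on $G$); "$G$ $\wedge$-semilattice" means the free frame on the $\wedge$-semilattice $G$ is used (equivalently, relations are added forcing finite meets, including the top $1$, to agree with those in $G$). Semilattices are unital. A presentation $\langle G \text{ }\wedge\text{-semilattice}\mid R\rangle_{\mathbf{Frm}}$ is $\mathbf{Sup}$-type if every relation in $R$ has the form $\bigvee A\le\bigvee B$ with $A,B\subseteq G$, and whenever $\bigvee A\le \bigvee B$ is in $R$, so is $\bigvee_{a\in A} (a\wedge c) \le \bigvee_{b\in B} (b\wedge c)$ for each $c\in G$.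
   Formalization: For arbitrary specified representations the claim fails, since ◇ need not be monotone; it is assumed that either each s is among its own s_α in the representation of q^*q_!(s), or R contains the relation s ≤ t for all s ≤ t in G. *)

theory Defs
  imports Main "HOL-Library.FSet"
begin

section \<open>Frames and locale maps\<close>

text \<open>The class \<^class>\<open>complete_distrib_lattice\<close> of HOL asks for complete distributivity,
  which is stronger than the frame law.\<close>

class frame = complete_lattice +
  assumes inf_Sup_frame: "inf a (Sup B) = Sup (inf a ` B)"

definition frame_hom :: "('a::frame \<Rightarrow> 'b::frame) \<Rightarrow> bool" where
  "frame_hom h \<longleftrightarrow>
     h top = top \<and> (\<forall>a b. h (inf a b) = inf (h a) (h b)) \<and> (\<forall>S. h (Sup S) = Sup (h ` S))"

definition left_adjoint :: "('a::order \<Rightarrow> 'b::order) \<Rightarrow> ('b \<Rightarrow> 'a) \<Rightarrow> bool" where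
  "left_adjoint l r \<longleftrightarrow> (\<forall>x y. l x \<le> y \<longleftrightarrow> x \<le> r y)"

text \<open>A locale map \<open>q : X \<rightarrow> Y\<close> is given by its frame homomorphism \<open>q\<^sup>* : \<O>Y \<rightarrow> \<O>X\<close>.\<close>

definition semi_open :: "('y::frame \<Rightarrow> 'x::frame) \<Rightarrow> bool" where
  "semi_open qstar \<longleftrightarrow> frame_hom qstar \<and> (\<exists>qshriek. left_adjoint qshriek qstar)"

definition semi_open_quotient :: "('y::frame \<Rightarrow> 'x::frame) \<Rightarrow> bool" where
  "semi_open_quotient qstar \<longleftrightarrow> semi_open qstar \<and> inj qstar"


section \<open>The free frame on a set\<close>

text \<open>A finite set \<open>F\<close> of generators stands for the formal meet of its elements, so that larger
  sets are smaller in the free meet-semilattice; the free frame consists of the lower sets of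
  this semilattice. The generating set is the whole type \<open>'g\<close>; no structure of \<open>'g\<close> is used.\<close>

typedef 'g free_frame = "{D :: 'g fset set. \<forall>F\<in>D. \<forall>F'. F |\<subseteq>| F' \<longrightarrow> F' \<in> D}"
  by (rule exI[of _ "{}"]) simp

setup_lifting type_definition_free_frame

instantiation free_frame :: (type) frame
begin

lift_definition less_eq_free_frame :: "'g free_frame \<Rightarrow> 'g free_frame \<Rightarrow> bool" is "(\<subseteq>)" .
lift_definition less_free_frame :: "'g free_frame \<Rightarrow> 'g free_frame \<Rightarrow> bool" is "(\<subset>)" .
lift_definition inf_free_frame :: "'g free_frame \<Rightarrow> 'g free_frame \<Rightarrow> 'g free_frame" is "(\<inter>)"
  by blast
lift_definition sup_free_frame :: "'g free_frame \<Rightarrow> 'g free_frame \<Rightarrow> 'g free_frame" is "(\<union>)"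
  by blast
lift_definition top_free_frame :: "'g free_frame" is UNIV by simp
lift_definition bot_free_frame :: "'g free_frame" is "{}" by simp
lift_definition Inf_free_frame :: "'g free_frame set \<Rightarrow> 'g free_frame" is Inter by blast
lift_definition Sup_free_frame :: "'g free_frame set \<Rightarrow> 'g free_frame" is Union by blast

instance
  by standard
    (auto simp: less_eq_free_frame.rep_eq less_free_frame.rep_eq inf_free_frame.rep_eq
      sup_free_frame.rep_eq top_free_frame.rep_eq bot_free_frame.rep_eq Inf_free_frame.rep_eq
      Sup_free_frame.rep_eq Rep_free_frame_inject[symmetric])

end

lift_definition gen :: "'g \<Rightarrow> 'g free_frame" is "\<lambda>g. {F. g |\<in>| F}"
  by auto

lemma inf_INF_fset_union:
  fixes f :: "'g \<Rightarrow> 'l::complete_lattice"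
  shows "(INF g\<in>fset (F |\<union>| F'). f g) = inf (INF g\<in>fset F. f g) (INF g\<in>fset F'. f g)"
  by (simp add: INF_union)

lemma free_frame_expansion:
  "D = (SUP F\<in>Rep_free_frame D. Abs_free_frame {F'. F |\<subseteq>| F'})"
proof -
  have *: "Rep_free_frame (Abs_free_frame {F'. F |\<subseteq>| F'}) = {F'. F |\<subseteq>| F'}" for F :: "'a fset"
    by (rule Abs_free_frame_inverse) auto
  have "Rep_free_frame D = (\<Union>F\<in>Rep_free_frame D. {F'. F |\<subseteq>| F'})"
    using Rep_free_frame[of D] by auto
  also have "\<dots> = Rep_free_frame (SUP F\<in>Rep_free_frame D. Abs_free_frame {F'. F |\<subseteq>| F'})"
    by (simp add: Sup_free_frame.rep_eq image_image *)
  finally show ?thesis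
    by (simp add: Rep_free_frame_inject)
qed

lemma up_empty: "Abs_free_frame {F'. {||} |\<subseteq>| F'} = top"
  by (simp add: top_free_frame_def)

lemma up_finsert:
  "Abs_free_frame {F'. finsert g F |\<subseteq>| F'} = inf (gen g) (Abs_free_frame {F'. F |\<subseteq>| F'})"
proof -
  have *: "Rep_free_frame (Abs_free_frame {F'. F |\<subseteq>| F'}) = {F'. F |\<subseteq>| F'}" for F :: "'a fset"
    by (rule Abs_free_frame_inverse) auto
  show ?thesis
    by (subst Rep_free_frame_inject[symmetric]) (auto simp: * inf_free_frame.rep_eq gen.rep_eq)
qed

lemma frame_hom_on_up:
  fixes h :: "'g free_frame \<Rightarrow> 'l::frame"
  assumes "frame_hom h"
  shows "h (Abs_free_frame {F'. F |\<subseteq>| F'}) = (INF g\<in>fset F. h (gen g))"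
proof (induction F)
  case empty
  then show ?case unfolding up_empty using assms by (simp add: frame_hom_def)
next
  case (insert g F)
  then show ?case unfolding up_finsert using assms by (simp add: frame_hom_def)
qed

lemma frame_hom_free_extension:
  fixes f :: "'g \<Rightarrow> 'l::frame"
  shows "frame_hom (\<lambda>D. SUP F\<in>Rep_free_frame D. INF g\<in>fset F. f g)" (is "frame_hom ?h")
  unfolding frame_hom_def
proof (intro conjI allI)
  have "(INF g\<in>fset {||}. f g) \<le> ?h top"
    by (rule SUP_upper) (simp add: top_free_frame.rep_eq)
  then show "?h top = top" by (simp add: top_unique)
next
  fix D E :: "'g free_frame"
  show "?h (inf D E) = inf (?h D) (?h E)"
  proof (rule antisym)
    show "?h (inf D E) \<le> inf (?h D) (?h E)"
      by (intro le_infI SUP_subset_mono) (auto simp: inf_free_frame.rep_eq)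
    have "inf (INF g\<in>fset F. f g) (INF g\<in>fset F'. f g) \<le> ?h (inf D E)"
      if "F \<in> Rep_free_frame D" "F' \<in> Rep_free_frame E" for F F'
    proof -
      have "F |\<union>| F' \<in> Rep_free_frame (inf D E)"
        using that Rep_free_frame[of D] Rep_free_frame[of E]
        by (auto simp: inf_free_frame.rep_eq)
      then show ?thesis
        unfolding inf_INF_fset_union[symmetric] by (rule SUP_upper)
    qed
    then have "inf (?h E) (INF g\<in>fset F. f g) \<le> ?h (inf D E)" if "F \<in> Rep_free_frame D" for F
      using that by (subst inf.commute) (auto simp: inf_Sup_frame image_image intro!: SUP_least)
    then have "inf (?h E) (?h D) \<le> ?h (inf D E)"
      by (subst inf_Sup_frame) (auto simp: image_image intro!: SUP_least)
    then show "inf (?h D) (?h E) \<le> ?h (inf D E)"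
      by (subst inf.commute)
  qed
next
  fix S :: "'g free_frame set"
  show "?h (Sup S) = Sup (?h ` S)"
    by (simp add: Sup_free_frame.rep_eq SUP_UNION)
qed

lemma free_frame_universal:
  fixes f :: "'g \<Rightarrow> 'l::frame"
  shows "\<exists>!h. frame_hom h \<and> (\<forall>g. h (gen g) = f g)"
proof (rule ex1I)
  let ?h = "\<lambda>D. SUP F\<in>Rep_free_frame D. INF g\<in>fset F. f g"
  have "?h (gen g) = f g" for g
  proof (rule antisym)
    show "?h (gen g) \<le> f g"
      by (auto simp: gen.rep_eq intro!: SUP_least INF_lower)
    have "(INF g\<in>fset {|g|}. f g) \<le> ?h (gen g)"
      by (rule SUP_upper) (simp add: gen.rep_eq)
    then show "f g \<le> ?h (gen g)" by simp
  qed
  then show "frame_hom ?h \<and> (\<forall>g. ?h (gen g) = f g)"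
    using frame_hom_free_extension by blast
  fix h :: "'g free_frame \<Rightarrow> 'l"
  assume h: "frame_hom h \<and> (\<forall>g. h (gen g) = f g)"
  show "h = ?h"
  proof
    fix D
    have "h D = h (SUP F\<in>Rep_free_frame D. Abs_free_frame {F'. F |\<subseteq>| F'})"
      using free_frame_expansion[of D] by simp
    also have "\<dots> = (SUP F\<in>Rep_free_frame D. h (Abs_free_frame {F'. F |\<subseteq>| F'}))"
      using h by (simp add: frame_hom_def image_image)
    also have "\<dots> = ?h D"
      using h by (simp add: frame_hom_on_up)
    finally show "h D = ?h D" .
  qed
qed


section \<open>Presentations of frames\<close>

text \<open>A relation is a formal equation, that is, a pair of elements of the free frame; the formal
  inequality \<open>a \<le> b\<close> is the equation \<open>a \<sqinter> b = a\<close>.\<close>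

definition formal_le :: "'a::frame \<Rightarrow> 'a \<Rightarrow> 'a \<times> 'a" where
  "formal_le a b = (inf a b, a)"

definition frame_congruence :: "'a::frame rel \<Rightarrow> bool" where
  "frame_congruence E \<longleftrightarrow> equiv UNIV E \<and>
     (\<forall>a a' b b'. (a, a') \<in> E \<longrightarrow> (b, b') \<in> E \<longrightarrow> (inf a b, inf a' b') \<in> E) \<and>
     (\<forall>S \<subseteq> E. (Sup (fst ` S), Sup (snd ` S)) \<in> E)"

definition generated_congruence :: "'a::frame rel \<Rightarrow> 'a rel" where
  "generated_congruence P = \<Inter>{E. frame_congruence E \<and> P \<subseteq> E}"

lemma frame_congruence_generated: "frame_congruence (generated_congruence P)"
  unfolding frame_congruence_def
proof (intro conjI allI impI)
  have *: "refl E" "sym E" "trans E" if "frame_congruence E" for E :: "'a rel"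
    using that by (auto simp: frame_congruence_def equiv_def)
  show "equiv UNIV (generated_congruence P)"
  proof (rule equivI)
    show "refl (generated_congruence P)"
      using *(1) by (auto simp: generated_congruence_def refl_on_def)
    show "sym (generated_congruence P)"
      unfolding generated_congruence_def by (rule symI) (simp, metis *(2) symD)
    show "trans (generated_congruence P)"
      unfolding generated_congruence_def by (rule transI) (simp, metis *(3) transD)
  qed simp
next
  fix a a' b b'
  assume "(a, a') \<in> generated_congruence P" "(b, b') \<in> generated_congruence P"
  then show "(inf a b, inf a' b') \<in> generated_congruence P"
    unfolding generated_congruence_def frame_congruence_def by simp
next
  fix S assume S: "S \<subseteq> generated_congruence P"
  show "(Sup (fst ` S), Sup (snd ` S)) \<in> generated_congruence P"
    unfolding generated_congruence_def
  proof (rule InterI, clarify)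
    fix E :: "'a rel" assume E: "frame_congruence E" "P \<subseteq> E"
    then have "S \<subseteq> E"
      using S by (auto simp: generated_congruence_def)
    then show "(Sup (fst ` S), Sup (snd ` S)) \<in> E"
      using E(1) unfolding frame_congruence_def by blast
  qed
qed

text \<open>\<open>\<langle>'g | P\<rangle>\<close> is the quotient \<open>UNIV // generated_congruence P\<close> of the free frame, whose
  operations are computed on representatives. The following says that \<open>\<phi>\<close> is an isomorphism from
  this quotient frame onto the frame \<open>'l\<close>.\<close>

definition presentation_iso ::
  "'g free_frame rel \<Rightarrow> ('g free_frame set \<Rightarrow> 'l::frame) \<Rightarrow> bool" where
  "presentation_iso P \<phi> \<longleftrightarrow>
     bij_betw \<phi> (UNIV // generated_congruence P) UNIV \<and>
     frame_hom (\<lambda>a. \<phi> (generated_congruence P `` {a}))"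

text \<open>The frame \<open>'l\<close> is presented by generators \<open>'g\<close> and relations \<open>P\<close>, the generator \<open>g\<close>
  corresponding to the element \<open>\<iota> g\<close> of \<open>'l\<close>.\<close>

definition presented_by :: "'g free_frame rel \<Rightarrow> ('g \<Rightarrow> 'l::frame) \<Rightarrow> bool" where
  "presented_by P \<iota> \<longleftrightarrow>
     (\<exists>\<phi>. presentation_iso P \<phi> \<and> (\<forall>g. \<iota> g = \<phi> (generated_congruence P `` {gen g})))"

text \<open>The relations that make the generators a meet-semilattice, as implied by
  ``\<open>'g\<close> \<open>\<and>\<close>-semilattice'' in a presentation.\<close>

definition semilattice_relations :: "'g::bounded_semilattice_inf_top free_frame rel" where
  "semilattice_relations =
     insert (gen top, top) {(inf (gen a) (gen b), gen (inf a b)) | a b. True}"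

text \<open>A pair \<open>(A, B)\<close> of sets of generators encodes the relation \<open>\<Squnion>A \<le> \<Squnion>B\<close>.\<close>

definition join_relations :: "('g set \<times> 'g set) set \<Rightarrow> 'g free_frame rel" where
  "join_relations R = {formal_le (Sup (gen ` A)) (Sup (gen ` B)) | A B. (A, B) \<in> R}"

definition sup_type :: "('g::bounded_semilattice_inf_top set \<times> 'g set) set \<Rightarrow> bool" where
  "sup_type R \<longleftrightarrow>
     (\<forall>A B c. (A, B) \<in> R \<longrightarrow> ((\<lambda>a. inf a c) ` A, (\<lambda>b. inf b c) ` B) \<in> R)"

text \<open>The relations \<open>R\<close>, \<open>\<diamond>1 = 1\<close> and \<open>\<diamond>s \<and> \<diamond>t = \<Squnion>\<^sub>\<alpha>\<^sub>\<beta> \<diamond>(s\<^sub>\<alpha> \<and> t\<^sub>\<beta>)\<close>, where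
  \<open>\<diamond>g\<close> is \<open>gen g\<close> and \<open>rep s = {s\<^sub>\<alpha>}\<close> is the representation specified for \<open>q\<^sup>*q\<^sub>!(s)\<close>.

  These relations do not contain the order of \<open>'g\<close>, and for badly chosen representations they do
  not imply \<open>\<diamond>s \<le> \<diamond>t\<close> for \<open>s \<le> t\<close>. For example, let \<open>'g = {w < y, y' < a < 1}\<close> with
  \<open>y \<and> y' = w\<close>, let \<open>R\<close> be empty, so that \<open>\<O>X\<close> consists of the lower sets of \<open>'g\<close>, and let
  \<open>\<O>Y = {{}, {w, y, y', a}, 'g}\<close>. Take \<open>rep 1 = {1, y}\<close>,
  \<open>rep a = rep y = rep y' = {a}\<close> and \<open>rep w = {a, y, y'}\<close>. Then \<open>\<diamond>w = \<diamond>1 = 1\<close>,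
  \<open>\<diamond>a = \<diamond>y = \<diamond>y' = 0\<close> satisfies all relations in the two-element frame. The relations
  therefore present a frame with at least three points, whereas \<open>Y\<close> has two.
  Monotonicity of \<open>\<diamond>\<close> does follow if \<open>s\<close> is always listed in the representation of
  \<open>q\<^sup>*q\<^sub>!(s) \<ge> s\<close>, or if the order of \<open>'g\<close> is part of \<open>R\<close>.\<close>

definition diamond_relations ::
  "('g::bounded_semilattice_inf_top set \<times> 'g set) set \<Rightarrow> ('g \<Rightarrow> 'g set) \<Rightarrow> 'g free_frame rel" where
  "diamond_relations R rep =
     join_relations R \<union> {(gen top, top)} \<union>
     {(inf (gen s) (gen t), Sup {gen (inf a b) | a b. a \<in> rep s \<and> b \<in> rep t}) | s t. True}"

end

theory Submission
  imports Defs
begin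

text \<open>Both presentations make every element of the free frame congruent to a join of generators, so
  only joins of generators have to be compared. If \<open>q\<^sub>!(\<iota> g) \<le> q\<^sub>!(\<Squnion>\<iota>[A])\<close>, then by adjunction
  \<open>\<iota> g\<close> lies below the join of all \<open>\<iota> b\<close> with \<open>b\<close> in some \<open>rep a\<close>, \<open>a \<in> A\<close>. Since the presentation of
  \<open>\<O>X\<close> is Sup-type, this inequality already follows from monotonicity and the joins in \<open>R\<close>
  (the coverage theorem), hence it holds for the \<open>\<diamond>g\<close> as well; and \<open>\<diamond>b \<le> \<diamond>a\<close> is part of
  \<open>\<diamond>a \<and> \<diamond>a = \<Squnion>\<diamond>(a\<^sub>\<alpha> \<and> a\<^sub>\<beta>)\<close>, on the diagonal \<open>\<alpha> = \<beta>\<close>.\<close>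

section \<open>Frame homomorphisms and congruences\<close>

lemma frame_homD:
  assumes "frame_hom h"
  shows "h top = top" "h (inf a b) = inf (h a) (h b)" "h (Sup S) = Sup (h ` S)"
  using assms by (auto simp: frame_hom_def)

lemma inf_SUP_SUP:
  fixes f :: "'i \<Rightarrow> 'a::frame"
  shows "inf (SUP i\<in>I. f i) (SUP j\<in>J. g j) = (SUP j\<in>J. SUP i\<in>I. inf (f i) (g j))"
proof -
  have "inf (SUP i\<in>I. f i) b = (SUP i\<in>I. inf (f i) b)" for b
    by (subst inf.commute) (simp add: inf_Sup_frame image_image inf.commute)
  then show ?thesis
    by (simp add: inf_Sup_frame image_image)
qed

lemma left_adjoint_Sup:
  fixes l :: "'a::complete_lattice \<Rightarrow> 'b::complete_lattice"
  assumes "left_adjoint l r"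
  shows "l (Sup S) = Sup (l ` S)"
proof (rule antisym)
  have "x \<le> r (Sup (l ` S))" if "x \<in> S" for x
    using assms that by (metis left_adjoint_def Sup_upper imageI)
  then show "l (Sup S) \<le> Sup (l ` S)"
    using assms by (simp add: left_adjoint_def Sup_least)
  have "x \<le> r (l (Sup S))" if "x \<in> S" for x
    using assms that by (metis left_adjoint_def Sup_upper order_trans order_refl)
  then show "Sup (l ` S) \<le> l (Sup S)"
    using assms by (auto simp: left_adjoint_def intro!: SUP_least)
qed

text \<open>A triangle identity gives \<open>r (l (r y)) = r y\<close>, and injectivity cancels the
  outer \<open>r\<close>.\<close>

lemma left_adjoint_inj:
  assumes "left_adjoint l r" "inj r"
  shows "l (r y) = y"
proof -
  have "r (l (r y)) = r y"
    using assms(1) unfolding left_adjoint_def by (metis order.antisym order.refl order.trans)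
  then show ?thesis
    using assms(2) by (simp add: inj_eq)
qed

lemma frame_congruence_refl: "frame_congruence E \<Longrightarrow> (a, a) \<in> E"
  by (auto simp: frame_congruence_def equiv_def refl_on_def)

lemma frame_congruence_sym: "frame_congruence E \<Longrightarrow> (a, b) \<in> E \<Longrightarrow> (b, a) \<in> E"
  by (auto simp: frame_congruence_def equiv_def dest: symD)

lemma frame_congruence_trans:
  "frame_congruence E \<Longrightarrow> (a, b) \<in> E \<Longrightarrow> (b, c) \<in> E \<Longrightarrow> (a, c) \<in> E"
  by (auto simp: frame_congruence_def equiv_def dest: transD)

lemma frame_congruence_inf:
  "frame_congruence E \<Longrightarrow> (a, a') \<in> E \<Longrightarrow> (b, b') \<in> E \<Longrightarrow> (inf a b, inf a' b') \<in> E"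
  by (auto simp: frame_congruence_def)

lemma frame_congruence_SUP:
  assumes "frame_congruence E" "\<And>i. i \<in> I \<Longrightarrow> (f i, g i) \<in> E"
  shows "(SUP i\<in>I. f i, SUP i\<in>I. g i) \<in> E"
proof -
  have "(\<lambda>i. (f i, g i)) ` I \<subseteq> E"
    using assms(2) by auto
  then have "(Sup (fst ` (\<lambda>i. (f i, g i)) ` I), Sup (snd ` (\<lambda>i. (f i, g i)) ` I)) \<in> E"
    using assms(1) unfolding frame_congruence_def by blast
  then show ?thesis
    by (simp add: image_image)
qed

text \<open>Membership of \<open>formal_le a b\<close> in a congruence \<open>E\<close> is the order
  of the quotient frame. This lemma and the next ones let inequalities be chained there without
  forming the quotient.\<close>

lemma formal_le_of_le: "frame_congruence E \<Longrightarrow> a \<le> b \<Longrightarrow> formal_le a b \<in> E"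
  by (simp add: formal_le_def inf_absorb1 frame_congruence_refl)

lemma formal_le_of_cong: "frame_congruence E \<Longrightarrow> (a, b) \<in> E \<Longrightarrow> formal_le a b \<in> E"
  unfolding formal_le_def
  by (metis frame_congruence_inf frame_congruence_refl frame_congruence_sym inf_idem)

lemma formal_le_trans:
  assumes E: "frame_congruence E" and "formal_le a b \<in> E" "formal_le b c \<in> E"
  shows "formal_le a c \<in> E"
proof -
  have ab: "(inf a b, a) \<in> E" and bc: "(inf b c, b) \<in> E"
    using assms by (simp_all add: formal_le_def)
  have "(inf (inf a b) c, inf a c) \<in> E"
    by (intro frame_congruence_inf ab frame_congruence_refl E)
  moreover have "(inf a (inf b c), inf a b) \<in> E"
    by (intro frame_congruence_inf bc frame_congruence_refl E)
  ultimately show ?thesis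
    unfolding formal_le_def
    by (metis E ab frame_congruence_sym frame_congruence_trans inf.assoc)
qed

lemma formal_le_antisym:
  assumes E: "frame_congruence E" and "formal_le a b \<in> E" "formal_le b a \<in> E"
  shows "(a, b) \<in> E"
  using assms unfolding formal_le_def
  by (metis frame_congruence_sym frame_congruence_trans inf.commute)

text \<open>The frame law carries the meet with \<open>b\<close> into the join, where the congruence
  acts on each member.\<close>

lemma formal_le_SUP_least:
  assumes E: "frame_congruence E" and "\<And>i. i \<in> I \<Longrightarrow> formal_le (f i) b \<in> E"
  shows "formal_le (SUP i\<in>I. f i) b \<in> E"
proof -
  have "(SUP i\<in>I. inf (f i) b, SUP i\<in>I. f i) \<in> E"
    using assms by (intro frame_congruence_SUP) (auto simp: formal_le_def)
  moreover have "(SUP i\<in>I. inf (f i) b) = inf (SUP i\<in>I. f i) b"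
    by (subst inf.commute, subst inf.commute[of _ b]) (simp add: inf_Sup_frame image_image)
  ultimately show ?thesis
    by (simp add: formal_le_def)
qed

lemma frame_congruence_kernel:
  assumes "frame_hom h"
  shows "frame_congruence {(a, b). h a = h b}"
  unfolding frame_congruence_def
proof (intro conjI allI impI)
  show "equiv UNIV {(a, b). h a = h b}"
    by (auto simp: equiv_def refl_on_def sym_def trans_def)
next
  fix S assume "S \<subseteq> {(a, b). h a = h b}"
  then have "(h \<circ> fst) ` S = (h \<circ> snd) ` S"
    by (intro image_cong) auto
  then show "(Sup (fst ` S), Sup (snd ` S)) \<in> {(a, b). h a = h b}"
    using assms by (simp add: frame_homD image_comp)
qed (use assms in \<open>auto simp: frame_homD\<close>)

lemma generated_congruence_least:
  "frame_congruence E \<Longrightarrow> P \<subseteq> E \<Longrightarrow> generated_congruence P \<subseteq> E"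
  by (auto simp: generated_congruence_def)

lemma generated_congruence_base: "P \<subseteq> generated_congruence P"
  by (auto simp: generated_congruence_def)

section \<open>Presentations through the kernel\<close>

text \<open>First isomorphism theorem: an isomorphism out of the quotient amounts to a surjective
  homomorphism with the right kernel.\<close>

lemma presentation_iso_of_kernel:
  fixes h :: "'g free_frame \<Rightarrow> 'l::frame"
  assumes h: "frame_hom h" "surj h"
    and ker: "\<And>a b. h a = h b \<longleftrightarrow> (a, b) \<in> generated_congruence P"
  shows "\<exists>\<psi> :: 'g free_frame set \<Rightarrow> 'l. presentation_iso P \<psi>"
proof -
  let ?E = "generated_congruence P"
  \<comment> \<open>On a class of the congruence \<open>h\<close> takes a single value, which
    \<open>the_elem\<close> extracts.\<close>
  define \<psi> where "\<psi> C = the_elem (h ` C)" for C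
  have "h ` (?E `` {a}) = {h a}" for a
    by (auto simp: ker[symmetric])
  then have val: "\<psi> (?E `` {a}) = h a" for a
    by (simp add: \<psi>_def)
  have eq: "equiv UNIV ?E"
    using frame_congruence_generated by (auto simp: frame_congruence_def)
  have "inj_on \<psi> (UNIV // ?E)"
  proof (rule inj_onI)
    fix C D assume CD: "C \<in> UNIV // ?E" "D \<in> UNIV // ?E" "\<psi> C = \<psi> D"
    from CD obtain a b where "C = ?E `` {a}" "D = ?E `` {b}"
      by (auto elim!: quotientE)
    then show "C = D"
      using CD(3) val ker equiv_class_eq[OF eq] by auto
  qed
  moreover have "\<psi> ` (UNIV // ?E) = UNIV"
    using h(2) val by (auto simp: quotient_def image_UN)
  ultimately have "presentation_iso P \<psi>"
    using h(1) by (simp add: presentation_iso_def bij_betw_def val)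
  then show ?thesis by blast
qed

text \<open>Here \<open>h\<close> is the quotient map followed by the given isomorphism, so that
  later arguments can use elements of the free frame instead of classes.\<close>

lemma kernel_of_presented_by:
  fixes \<iota> :: "'g \<Rightarrow> 'l::frame"
  assumes "presented_by P \<iota>"
  obtains h where "frame_hom h" "surj h" "\<And>g. h (gen g) = \<iota> g"
    "\<And>a b. h a = h b \<longleftrightarrow> (a, b) \<in> generated_congruence P"
proof -
  let ?E = "generated_congruence P"
  obtain \<phi> where bij: "bij_betw \<phi> (UNIV // ?E) UNIV"
    and hom: "frame_hom (\<lambda>a. \<phi> (?E `` {a}))"
    and gens: "\<And>g. \<iota> g = \<phi> (?E `` {gen g})"
    using assms by (auto simp: presented_by_def presentation_iso_def)
  have eq: "equiv UNIV ?E"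
    using frame_congruence_generated by (auto simp: frame_congruence_def)
  have "surj (\<lambda>a. \<phi> (?E `` {a}))"
  proof -
    have "\<phi> ` (UNIV // ?E) = UNIV"
      using bij by (simp add: bij_betw_def)
    then show ?thesis
      by (auto simp: quotient_def image_UN)
  qed
  moreover have "\<phi> (?E `` {a}) = \<phi> (?E `` {b}) \<longleftrightarrow> (a, b) \<in> ?E" for a b
    using inj_on_eq_iff[OF bij_betw_imp_inj_on[OF bij] quotientI quotientI]
    by (simp add: eq_equiv_class_iff[OF eq])
  ultimately show thesis
    using that[OF hom] gens by simp
qed

text \<open>Every element is a join of finite meets of generators, with \<open>top\<close> as the
  empty meet.\<close>

lemma free_frame_induct [consumes 0, case_names top gen inf Sup]:
  assumes "Q top" "\<And>g. Q (gen g)" "\<And>a b. Q a \<Longrightarrow> Q b \<Longrightarrow> Q (inf a b)"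
    and Sup: "\<And>S. (\<And>a. a \<in> S \<Longrightarrow> Q a) \<Longrightarrow> Q (Sup S)"
  shows "Q (D :: 'g free_frame)"
proof -
  have "Q (Abs_free_frame {F'. F |\<subseteq>| F'})" for F :: "'g fset"
    by (induction F) (auto simp only: up_empty up_finsert intro: assms)
  then show ?thesis
    by (subst free_frame_expansion) (auto intro: Sup)
qed

text \<open>Distributivity reduces a meet of two joins of generators to meets of two generators. In
  the presentation of \<open>\<O>X\<close> such a meet is a single generator, in the diamond
  presentation a join over the representations.\<close>

lemma congruent_to_join_of_gens:
  assumes E: "frame_congruence E" and top: "(gen top, top) \<in> E"
    and meet: "\<And>s t. \<exists>A. (inf (gen s) (gen t), Sup (gen ` A)) \<in> E"
  shows "\<exists>A. (D, Sup (gen ` A)) \<in> E"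
proof (induction D rule: free_frame_induct)
  case top
  have "(top, Sup (gen ` {top})) \<in> E"
    using frame_congruence_sym[OF E assms(2)] by simp
  then show ?case ..
next
  case (gen g)
  have "(gen g, Sup (gen ` {g})) \<in> E"
    using frame_congruence_refl[OF E] by simp
  then show ?case ..
next
  case (inf a b)
  then obtain A B where AB: "(a, Sup (gen ` A)) \<in> E" "(b, Sup (gen ` B)) \<in> E"
    by blast
  obtain C where C: "\<And>s t. (inf (gen s) (gen t), Sup (gen ` C s t)) \<in> E"
    using meet by metis
  have "inf (Sup (gen ` A)) (Sup (gen ` B)) = (SUP b\<in>B. SUP a\<in>A. inf (gen a) (gen b))"
    by (rule inf_SUP_SUP)
  moreover have "(\<dots>, SUP b\<in>B. SUP a\<in>A. Sup (gen ` C a b)) \<in> E"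
    by (intro frame_congruence_SUP E C)
  moreover have "(SUP b\<in>B. SUP a\<in>A. Sup (gen ` C a b)) = Sup (gen ` (\<Union>b\<in>B. \<Union>a\<in>A. C a b))"
    by (simp add: SUP_UNION)
  ultimately show ?case
    by (metis frame_congruence_inf[OF E AB] frame_congruence_trans[OF E])
next
  case (Sup S)
  then obtain A where A: "\<And>a. a \<in> S \<Longrightarrow> (a, Sup (gen ` A a)) \<in> E"
    by metis
  have "(SUP a\<in>S. a, SUP a\<in>S. Sup (gen ` A a)) \<in> E"
    by (intro frame_congruence_SUP E A)
  then have "(Sup S, Sup (gen ` (\<Union>a\<in>S. A a))) \<in> E"
    by (simp add: SUP_UNION)
  then show ?case ..
qed

section \<open>The coverage theorem\<close>

text \<open>This is the frame homomorphism into the lower sets of \<open>'g\<close> that extends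
  \<open>g \<mapsto> {..g}\<close>: each \<open>F\<close> contributes the intersection of its
  principal lower sets.\<close>

definition gens_below :: "'g::order free_frame \<Rightarrow> 'g set" where
  "gens_below D = {x. \<exists>F\<in>Rep_free_frame D. \<forall>g\<in>fset F. x \<le> g}"

lemma gens_below_simps:
  "gens_below top = UNIV"
  "gens_below (gen g) = {..g}"
  "gens_below (Sup S) = (\<Union>D\<in>S. gens_below D)"
proof -
  show "gens_below top = UNIV"
    by (auto simp: gens_below_def top_free_frame.rep_eq intro: exI[of _ "{||}"])
  have "\<exists>F. g |\<in>| F \<and> (\<forall>g'\<in>fset F. x \<le> g')" if "x \<le> g" for x
    using that by (intro exI[of _ "{|g|}"]) simp
  then show "gens_below (gen g) = {..g}"
    by (auto simp: gens_below_def gen.rep_eq)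
  show "gens_below (Sup S) = (\<Union>D\<in>S. gens_below D)"
    by (auto simp: gens_below_def Sup_free_frame.rep_eq)
qed

lemma gens_below_inf: "gens_below (inf D E) = gens_below D \<inter> gens_below E"
proof (intro equalityI subsetI)
  fix x assume "x \<in> gens_below D \<inter> gens_below E"
  then obtain F F' where F: "F \<in> Rep_free_frame D" "F' \<in> Rep_free_frame E"
    and x: "\<forall>g\<in>fset (F |\<union>| F'). x \<le> g"
    by (auto simp: gens_below_def)
  have "F |\<union>| F' \<in> Rep_free_frame (inf D E)"
    using F Rep_free_frame[of D] Rep_free_frame[of E] by (auto simp: inf_free_frame.rep_eq)
  then show "x \<in> gens_below (inf D E)"
    using x by (auto simp: gens_below_def)
qed (auto simp: gens_below_def inf_free_frame.rep_eq)

lemma gens_below_lower: "x \<in> gens_below D \<Longrightarrow> y \<le> x \<Longrightarrow> y \<in> gens_below D"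
  by (auto simp: gens_below_def intro: order_trans)

text \<open>Modulo a set \<open>I\<close> of generators, \<open>D\<close> is determined by the residuals \<open>{c. D \<and> c \<subseteq> I}\<close>; testing
  against every \<open>c\<close>, not only \<open>c = 1\<close>, is what makes the relation compatible with meets.\<close>

definition residual_congruence :: "'g::order set \<Rightarrow> 'g free_frame rel" where
  "residual_congruence I =
     {(D, D'). \<forall>c. gens_below D \<inter> {..c} \<subseteq> I \<longleftrightarrow> gens_below D' \<inter> {..c} \<subseteq> I}"

lemma frame_congruence_residual: "frame_congruence (residual_congruence I)"
  unfolding frame_congruence_def
proof (intro conjI allI impI)
  show "equiv UNIV (residual_congruence I)"
    by (auto simp: equiv_def refl_on_def sym_def trans_def residual_congruence_def)
next
  fix a a' b b' :: "'a free_frame"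
  assume a: "(a, a') \<in> residual_congruence I" and b: "(b, b') \<in> residual_congruence I"
  \<comment> \<open>The element \<open>e\<close> enters the right side only through its residuals,
    so a congruent one may replace it. Commutativity of the meet then handles the other
    factor.\<close>
  have curry: "gens_below (inf d e) \<inter> {..c} \<subseteq> I \<longleftrightarrow>
      (\<forall>x\<in>gens_below d. x \<le> c \<longrightarrow> gens_below e \<inter> {..x} \<subseteq> I)" for d e :: "'a free_frame" and c
    by (auto simp: gens_below_inf) (meson atMost_iff gens_below_lower order_refl order_trans IntI subsetD)+
  have "(inf a b, inf a b') \<in> residual_congruence I"
    using b unfolding residual_congruence_def by (simp add: curry)
  moreover have "(inf b' a, inf b' a') \<in> residual_congruence I"
    using a unfolding residual_congruence_def by (simp add: curry)
  ultimately show "(inf a b, inf a' b') \<in> residual_congruence I"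
    by (simp add: residual_congruence_def inf.commute)
next
  fix S assume "S \<subseteq> residual_congruence I"
  then have "gens_below (fst p) \<inter> {..c} \<subseteq> I \<longleftrightarrow> gens_below (snd p) \<inter> {..c} \<subseteq> I" if "p \<in> S" for p c
    using that subsetD[of S _ p] by (auto simp only: residual_congruence_def mem_Collect_eq case_prod_unfold)
  moreover have "(\<Union>D\<in>f ` S. gens_below D) \<inter> {..c} \<subseteq> I \<longleftrightarrow> (\<forall>p\<in>S. gens_below (f p) \<inter> {..c} \<subseteq> I)"
    for f :: "_ \<Rightarrow> 'a free_frame" and c
    by blast
  ultimately show "(Sup (fst ` S), Sup (snd ` S)) \<in> residual_congruence I"
    by (simp only: residual_congruence_def gens_below_simps mem_Collect_eq case_prod_conv) blast
qed

text \<open>Every relation of the presentation lies in \<open>residual_congruence I\<close>, hence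
  so does every inequality derivable from them. The set \<open>I\<close> stays arbitrary so that it
  can later be defined through another presentation.\<close>

lemma coverage:
  fixes R :: "('g::bounded_semilattice_inf_top set \<times> 'g set) set"
  assumes R: "sup_type R"
    and lower: "\<And>x y. x \<in> I \<Longrightarrow> y \<le> x \<Longrightarrow> y \<in> I"
    and closed: "\<And>A B. (A, B) \<in> R \<Longrightarrow> B \<subseteq> I \<Longrightarrow> A \<subseteq> I"
    and le: "formal_le (gen g) (Sup (gen ` B))
      \<in> generated_congruence (semilattice_relations \<union> join_relations R)"
    and B: "B \<subseteq> I"
  shows "g \<in> I"
proof -
  have join: "formal_le (Sup (gen ` A)) (Sup (gen ` B)) \<in> residual_congruence I"
    if AB: "(A, B) \<in> R" for A B
  proof -
    have "x \<in> I" if *: "(\<Union>a\<in>A. {..a}) \<inter> (\<Union>b\<in>B. {..b}) \<inter> {..c} \<subseteq> I"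
      and x: "a \<in> A" "x \<le> a" "x \<le> c" for a c x
    proof -
      \<comment> \<open>Stability of \<open>R\<close> under meets restricts the relation to
        \<open>x\<close>: each \<open>inf b x\<close> lies below \<open>a\<close>, \<open>b\<close>
        and \<open>c\<close>, hence in \<open>I\<close>, while \<open>inf a x\<close> is
        \<open>x\<close> itself.\<close>
      have "((\<lambda>a. inf a x) ` A, (\<lambda>b. inf b x) ` B) \<in> R"
        using R AB by (auto simp: sup_type_def)
      moreover have "(\<lambda>b. inf b x) ` B \<subseteq> I"
        using * x by (force intro: le_infI2)
      ultimately have "inf a x \<in> I"
        using closed x(1) by blast
      then show ?thesis
        using x(2) by (simp add: inf_absorb2)
    qed
    then show ?thesis
      by (fastforce simp: formal_le_def residual_congruence_def gens_below_inf gens_below_simps)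
  qed
  \<comment> \<open>\<open>gens_below\<close> sends both sides of each semilattice relation to the
    same lower set, so these relations hold whatever \<open>I\<close> is.\<close>
  have "{..top} = (UNIV :: 'g set)" "{..a} \<inter> {..b} = {..inf a b}" for a b :: 'g
    by auto
  then have "semilattice_relations \<subseteq> residual_congruence I"
    unfolding semilattice_relations_def residual_congruence_def
    by (auto simp: gens_below_inf gens_below_simps)
  then have "generated_congruence (semilattice_relations \<union> join_relations R)
      \<subseteq> residual_congruence I"
    using join by (intro generated_congruence_least frame_congruence_residual)
      (auto simp: join_relations_def)
  then have "formal_le (gen g) (Sup (gen ` B)) \<in> residual_congruence I"
    using le by blast
  \<comment> \<open>The test at \<open>c = top\<close> is plain inclusion in
    \<open>I\<close>.\<close>
  then have "{..g} \<inter> (\<Union>b\<in>B. {..b}) \<inter> {..top} \<subseteq> I \<longleftrightarrow> {..g} \<inter> {..top} \<subseteq> I"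
    unfolding formal_le_def residual_congruence_def by (simp add: gens_below_inf gens_below_simps)
  moreover have "{..g} \<inter> (\<Union>b\<in>B. {..b}) \<inter> {..top} \<subseteq> I"
    using B lower by blast
  ultimately show ?thesis
    by auto
qed

section \<open>Semi-open quotients\<close>

text \<open>The last hypothesis secures monotonicity of \<open>\<diamond>\<close>; the example
  preceding \<open>diamond_relations\<close> shows how the isomorphism can fail without it.\<close>

theorem proposition3p1:
  fixes R :: "('g::bounded_semilattice_inf_top set \<times> 'g set) set"
    and \<iota> :: "'g \<Rightarrow> 'x::frame"
    and qstar :: "'y::frame \<Rightarrow> 'x"
    and qshriek :: "'x \<Rightarrow> 'y"
    and rep :: "'g \<Rightarrow> 'g set"
  assumes "sup_type R"
    and "presented_by (semilattice_relations \<union> join_relations R) \<iota>"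
    and "semi_open_quotient qstar"
    and "left_adjoint qshriek qstar"
    and "\<And>s. qstar (qshriek (\<iota> s)) = Sup (\<iota> ` rep s)"
    and "(\<forall>s. s \<in> rep s) \<or> (\<forall>s t. s \<le> t \<longrightarrow> ({s}, {t}) \<in> R)"
  shows "\<exists>\<psi> :: 'g free_frame set \<Rightarrow> 'y. presentation_iso (diamond_relations R rep) \<psi>"
proof -
  let ?PX = "semilattice_relations \<union> join_relations R"
  let ?PY = "diamond_relations R rep"
  let ?E = "generated_congruence ?PY"

  \<comment> \<open>The frame \<open>\<O>X\<close> and its generators\<close>
  obtain k where k: "frame_hom k" "surj k" and k_gen: "\<And>g. k (gen g) = \<iota> g"
    and k_ker: "\<And>a b. k a = k b \<longleftrightarrow> (a, b) \<in> generated_congruence ?PX"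
    using kernel_of_presented_by[OF assms(2)] by blast
  have k_join: "k (Sup (gen ` A)) = Sup (\<iota> ` A)" for A
    using k(1) by (simp add: frame_homD image_image k_gen)
  have k_le: "k a \<le> k b \<longleftrightarrow> formal_le a b \<in> generated_congruence ?PX" for a b
    unfolding formal_le_def k_ker[symmetric] using k(1)
    by (simp add: frame_homD le_iff_inf)
  have base_X: "p \<in> ?PX \<Longrightarrow> p \<in> generated_congruence ?PX" for p
    using generated_congruence_base by blast
  have \<iota>_top: "\<iota> top = top"
    using base_X[of "(gen top, top)"] k_ker[of "gen top" top] k(1)
    by (simp add: semilattice_relations_def k_gen frame_homD)
  have \<iota>_inf: "inf (\<iota> a) (\<iota> b) = \<iota> (inf a b)" for a b
    using base_X[of "(inf (gen a) (gen b), gen (inf a b))"]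
      k_ker[of "inf (gen a) (gen b)" "gen (inf a b)"] k(1)
    by (auto simp: semilattice_relations_def k_gen frame_homD)
  have \<iota>_R: "Sup (\<iota> ` A) \<le> Sup (\<iota> ` B)" if "(A, B) \<in> R" for A B
    unfolding k_join[symmetric] k_le using that by (intro base_X) (auto simp: join_relations_def)
  have \<iota>_dense: "\<exists>A. x = Sup (\<iota> ` A)" for x
  proof -
    obtain D where "x = k D"
      using k(2) by blast
    have "\<exists>A. (D, Sup (gen ` A)) \<in> generated_congruence ?PX"
    proof (rule congruent_to_join_of_gens[OF frame_congruence_generated])
      show "(gen top, top) \<in> generated_congruence ?PX"
        by (rule base_X) (simp add: semilattice_relations_def)
      have "(inf (gen s) (gen t), Sup (gen ` {inf s t})) \<in> generated_congruence ?PX" for s t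
        by (rule base_X) (auto simp: semilattice_relations_def)
      then show "\<exists>A. (inf (gen s) (gen t), Sup (gen ` A)) \<in> generated_congruence ?PX" for s t
        by blast
    qed
    then show ?thesis
      using \<open>x = k D\<close> k_ker k_join by metis
  qed

  \<comment> \<open>The homomorphism from the free frame onto \<open>\<O>Y\<close>\<close>
  have q: "frame_hom qstar" "inj qstar"
    using assms(3) by (auto simp: semi_open_quotient_def semi_open_def)
  note q_Sup = left_adjoint_Sup[OF assms(4)] and q_q = left_adjoint_inj[OF assms(4) q(2)]
  have q_mono: "qshriek a \<le> qshriek b" if "a \<le> b" for a b
    using q_Sup[of "{a, b}"] that by (simp add: sup.absorb_iff2)

  \<comment> \<open>The map \<open>qshriek\<close> after \<open>k\<close> would not do, since
    \<open>qshriek\<close> need not preserve finite meets. Agreement of \<open>h\<close> with it is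
    established on joins of generators.\<close>
  obtain h where h: "frame_hom h" and h_gen: "\<And>g. h (gen g) = qshriek (\<iota> g)"
    using free_frame_universal[of "\<lambda>g. qshriek (\<iota> g)"] by blast
  have h_join: "h (Sup (gen ` A)) = qshriek (Sup (\<iota> ` A))" for A
    using h by (simp add: frame_homD image_image h_gen q_Sup)
  have "surj h"
  proof (rule surjI)
    fix y
    \<comment> \<open>The element \<open>qstar y\<close> is a join of generators, and
      \<open>qshriek\<close> sends it back to \<open>y\<close>.\<close>
    show "h (Sup (gen ` (SOME A. qstar y = Sup (\<iota> ` A)))) = y"
      unfolding h_join someI_ex[OF \<iota>_dense, symmetric] by (rule q_q)
  qed

  \<comment> \<open>Validity of the diamond relations in \<open>\<O>Y\<close>\<close>
  have "?PY \<subseteq> {(a, b). h a = h b}"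
  proof -
    have "inf (h (Sup (gen ` A))) (h (Sup (gen ` B))) = h (Sup (gen ` A))" if "(A, B) \<in> R" for A B
      using q_mono[OF \<iota>_R[OF that]] by (simp only: h_join inf_absorb1)
    moreover have "h (gen top) = top"
      using q_q[of top] q(1) by (simp add: h_gen \<iota>_top frame_homD)
    moreover have "inf (h (gen s)) (h (gen t)) =
        h (Sup {gen (inf a b) | a b. a \<in> rep s \<and> b \<in> rep t})" for s t
    proof -
      \<comment> \<open>Inserting \<open>qshriek\<close> after \<open>qstar\<close> moves the meet
        into \<open>\<O>X\<close>, where the representations are available.\<close>
      have "inf (h (gen s)) (h (gen t)) = qshriek (qstar (inf (h (gen s)) (h (gen t))))"
        by (simp add: q_q)
      also have "\<dots> = qshriek (inf (Sup (\<iota> ` rep s)) (Sup (\<iota> ` rep t)))"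
        using q(1) by (simp add: frame_homD h_gen assms(5))
      also have "inf (Sup (\<iota> ` rep s)) (Sup (\<iota> ` rep t)) =
          Sup (\<iota> ` (\<Union>b\<in>rep t. (\<lambda>a. inf a b) ` rep s))"
        by (simp add: inf_SUP_SUP image_image SUP_UNION \<iota>_inf)
      also have "(\<Union>b\<in>rep t. (\<lambda>a. inf a b) ` rep s) = {inf a b | a b. a \<in> rep s \<and> b \<in> rep t}"
        by auto
      also have "qshriek (Sup (\<iota> ` \<dots>)) = h (Sup (gen ` {inf a b | a b. a \<in> rep s \<and> b \<in> rep t}))"
        by (simp only: h_join)
      also have "gen ` {inf a b | a b. a \<in> rep s \<and> b \<in> rep t} =
          {gen (inf a b) | a b. a \<in> rep s \<and> b \<in> rep t}"
        by auto
      finally show ?thesis .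
    qed
    ultimately show ?thesis
      using h by (auto simp: diamond_relations_def join_relations_def formal_le_def frame_homD(1,2))
  qed
  then have sound: "?E \<subseteq> {(a, b). h a = h b}"
    by (intro generated_congruence_least frame_congruence_kernel h)

  \<comment> \<open>Inequalities derivable from the diamond relations\<close>
  note E = frame_congruence_generated[of ?PY]
  have base: "p \<in> ?PY \<Longrightarrow> p \<in> ?E" for p
    using generated_congruence_base by blast
  have meet: "(inf (gen s) (gen t), Sup {gen (inf a b) | a b. a \<in> rep s \<and> b \<in> rep t}) \<in> ?E" for s t
    by (rule base) (auto simp: diamond_relations_def)
  have gen_R: "formal_le (Sup (gen ` A)) (Sup (gen ` B)) \<in> ?E" if "(A, B) \<in> R" for A B
    using that by (intro base) (auto simp: diamond_relations_def join_relations_def)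
  have gen_mono: "formal_le (gen s) (gen t) \<in> ?E" if "s \<le> t" for s t
    using assms(6)
  proof
    assume "\<forall>s t. s \<le> t \<longrightarrow> ({s}, {t}) \<in> R"
    then show ?thesis
      using gen_R[of "{s}" "{t}"] that by simp
  next
    assume "\<forall>s. s \<in> rep s"
    \<comment> \<open>With \<open>s\<close> in \<open>rep s\<close> and \<open>t\<close> in
      \<open>rep t\<close>, the generator \<open>inf s t\<close>, which equals \<open>s\<close>, is
      among those joined.\<close>
    then have "gen (inf s t) \<le> Sup {gen (inf a b) | a b. a \<in> rep s \<and> b \<in> rep t}"
      by (intro Sup_upper) blast
    then have "formal_le (gen s) (Sup {gen (inf a b) | a b. a \<in> rep s \<and> b \<in> rep t}) \<in> ?E"
      using that by (intro formal_le_of_le E) (simp add: inf_absorb1)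
    moreover have "formal_le (Sup {gen (inf a b) | a b. a \<in> rep s \<and> b \<in> rep t})
        (inf (gen s) (gen t)) \<in> ?E"
      by (rule formal_le_of_cong[OF E frame_congruence_sym[OF E meet]])
    moreover have "formal_le (inf (gen s) (gen t)) (gen t) \<in> ?E"
      by (intro formal_le_of_le E) simp
    ultimately show ?thesis
      using formal_le_trans[OF E] by blast
  qed
  have gen_rep: "formal_le (gen b) (gen a) \<in> ?E" if "b \<in> rep a" for a b
  proof -
    have "gen (inf b b) \<le> Sup {gen (inf b c) | b c. b \<in> rep a \<and> c \<in> rep a}"
      using that by (intro Sup_upper) blast
    then have "formal_le (gen b) (Sup {gen (inf b c) | b c. b \<in> rep a \<and> c \<in> rep a}) \<in> ?E"
      by (intro formal_le_of_le E) simp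
    moreover have "formal_le (Sup {gen (inf b c) | b c. b \<in> rep a \<and> c \<in> rep a}) (gen a) \<in> ?E"
      using formal_le_of_cong[OF E frame_congruence_sym[OF E meet[of a a]]] by simp
    ultimately show ?thesis
      using formal_le_trans[OF E] by blast
  qed

  \<comment> \<open>Completeness of the diamond relations\<close>
  have complete_le: "formal_le (Sup (gen ` A)) (Sup (gen ` B)) \<in> ?E"
    if le: "qshriek (Sup (\<iota> ` A)) \<le> qshriek (Sup (\<iota> ` B))" for A B
  proof (intro formal_le_SUP_least E)
    fix g assume "g \<in> A"
    let ?C = "\<Union>b\<in>B. rep b"
    \<comment> \<open>The set fed to \<open>coverage\<close>: it is a lower set by
      \<open>gen_mono\<close> and closed under \<open>R\<close> by \<open>gen_R\<close>.\<close>
    let ?I = "{x. formal_le (gen x) (Sup (gen ` B)) \<in> ?E}"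
    have "\<iota> g \<le> qstar (qshriek (Sup (\<iota> ` B)))"
      using le \<open>g \<in> A\<close> assms(4) by (meson SUP_upper left_adjoint_def order_trans)
    also have "\<dots> = Sup (\<iota> ` ?C)"
      using q(1) by (simp add: q_Sup frame_homD image_image assms(5) SUP_UNION)
    finally have "formal_le (gen g) (Sup (gen ` ?C)) \<in> generated_congruence ?PX"
      by (simp only: k_le[symmetric] k_join k_gen)
    then have "g \<in> ?I"
    proof (rule coverage[OF assms(1), rotated 2])
      show "?C \<subseteq> ?I"
      proof
        fix x assume "x \<in> ?C"
        then obtain b where "b \<in> B" "x \<in> rep b"
          by blast
        moreover have "formal_le (gen b) (Sup (gen ` B)) \<in> ?E"
          using \<open>b \<in> B\<close> by (intro formal_le_of_le E SUP_upper)
        ultimately show "x \<in> ?I"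
          using gen_rep formal_le_trans[OF E] by blast
      qed
      show "y \<in> ?I" if "x \<in> ?I" "y \<le> x" for x y
        using that gen_mono formal_le_trans[OF E] by blast
      show "C \<subseteq> ?I" if CD: "(C, D) \<in> R" "D \<subseteq> ?I" for C D
      proof
        fix x assume "x \<in> C"
        then have "formal_le (gen x) (Sup (gen ` C)) \<in> ?E"
          by (intro formal_le_of_le E) (simp add: Sup_upper)
        moreover have "formal_le (Sup (gen ` D)) (Sup (gen ` B)) \<in> ?E"
          using CD by (intro formal_le_SUP_least E) auto
        ultimately show "x \<in> ?I"
          using gen_R[OF CD(1)] formal_le_trans[OF E] by blast
      qed
    qed
    then show "formal_le (gen g) (Sup (gen ` B)) \<in> ?E"
      by simp
  qed
  have complete: "(a, b) \<in> ?E" if "h a = h b" for a b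
  proof -
    have "\<exists>A. (D, Sup (gen ` A)) \<in> ?E" for D
    proof (rule congruent_to_join_of_gens[OF E])
      show "(gen top, top) \<in> ?E"
        by (rule base) (simp add: diamond_relations_def)
      have "{gen (inf a b) | a b. a \<in> rep s \<and> b \<in> rep t} =
          gen ` {inf a b | a b. a \<in> rep s \<and> b \<in> rep t}" for s t
        by auto
      then show "\<exists>A. (inf (gen s) (gen t), Sup (gen ` A)) \<in> ?E" for s t
        using meet[of s t] by metis
    qed
    then obtain A B where AB: "(a, Sup (gen ` A)) \<in> ?E" "(b, Sup (gen ` B)) \<in> ?E"
      by metis
    \<comment> \<open>Soundness ensures that passing to congruent joins of generators leaves the
      values of \<open>h\<close> unchanged, which brings the claim into the scope of
      \<open>complete_le\<close>.\<close>
    then have "h (Sup (gen ` A)) = h (Sup (gen ` B))"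
      using sound that AB by (auto simp only: subset_iff mem_Collect_eq case_prod_conv split_paired_All)
    then have "(Sup (gen ` A), Sup (gen ` B)) \<in> ?E"
      by (intro formal_le_antisym E complete_le) (simp_all add: h_join)
    then show ?thesis
      using AB frame_congruence_trans[OF E] frame_congruence_sym[OF E] by blast
  qed
  show ?thesis
    using sound complete by (intro presentation_iso_of_kernel[OF h \<open>surj h\<close>]) blast
qed

end
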